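(* Let $\alpha\ge0$, $1<p<\infty$, $\gamma>0$ and $\beta,\mu\in\mathbb{R}$ with $0<\beta-\frac1p<\mu$. Consider on $\mathcal{T}_p^{(\alpha)}(t^\alpha)$ the operators $$\mathcal{S}_{\beta,\mu}f(t)=t^{\mu-\beta}\int_0^\infty\frac{s^{\beta-1}}{(s+t)^\mu}f(s)\,ds,\qquad \mathcal{C}_\gamma f(t)=\frac{\gamma}{t^\gamma}\int_0^t(t-s)^{\gamma-1}f(s)\,ds,\qquad t>0.$$ Then $\mathcal{S}_{\beta,\mu}\mathcal{C}_\gamma=\mathcal{C}_\gamma\mathcal{S}_{\beta,\mu}$ and $$\mathcal{S}_{\beta,\mu}\mathcal{C}_\gamma f(t)=\gamma B(\gamma,\mu-\beta+1)\,t^{\mu-\beta}\int_0^\infty\frac{s^{\beta-1}}{(s+t)^\mu}\,{}_2F_1\!\left(\mu,\gamma;\mu-\beta+1+\gamma;\frac{t}{s+t}\right)f(s)\,ds$$ for $t>0$ and $f\in\mathcal{T}_p^{(\alpha)}(t^\alpha)$. In particular: (i) for $\mu>\gamma+1-\frac1p$, $$\mathcal{S}_{\gamma+1,\mu}\,\mathcal{C}_\gamma=\gamma B(\gamma,\mu-\gamma)\,\mathcal{S}_{1,\mu-\gamma};$$ (ii) for $\beta>\frac1p$, $t>0$ and $f\in\mathcal{T}_p^{(\alpha)}(t^\alpha)$, $$\mathcal{S}_{\beta,\beta}\,\mathcal{C}_1f(t)=\frac1{(\beta-1)t}\int_0^\infty\frac{(t+s)^{\beta-1}-s^{\beta-1}}{(t+s)^{\beta-1}}f(s)\,ds\quad(\beta\ne1),\qquad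 \mathcal{S}_{1,1}\,\mathcal{C}_1f(t)=\frac1t\int_0^\infty\log\!\left(1+\frac ts\right)f(s)\,ds.$$
   Context: $B$ is the Beta function and ${}_2F_1$ the Gaussian hypergeometric function. Let $\mathcal{S}_+$ be the Schwartz class on $[0,\infty)$. For $f\in\mathcal{S}_+$ and $\alpha>0$ put $W_+^{-\alpha}f(t)=\frac1{\Gamma(\alpha)}\int_t^\infty(s-t)^{\alpha-1}f(s)\,ds$ and $W_+^{\alpha}f(t)=(-1)^n\frac{d^n}{dt^n}W_+^{-(n-\alpha)}f(t)$ with $n=[\alpha]+1$; $W_+^0=\mathrm{Id}$. For $1\le p<\infty$ and $\alpha>0$, $\mathcal{T}_p^{(\alpha)}(t^\alpha)$ is the completion of $\mathcal{S}_+$ in the norm $\|f\|_{\alpha,p}=\frac1{\Gamma(\alpha+1)}\left(\int_0^\infty|W_+^\alpha f(t)|^p t^{\alpha p}dt\right)^{1/p}$; $\mathcal{T}_p^{(0)}(t^0)=L^p(\mathbb{R}^+)$. These spaces are continuously embedded in $L^p(\mathbb{R}^+)$ and regarded as subspaces of it. The map $D_+^\alpha f(t)=\frac1{\Gamma(\alpha+1)}t^\alpha W_+^\alpha f(t)$ extends to an isometric isomorphism $\mathcal{T}_p^{(\alpha)}(t^\alpha)\to L^p(\mathbb{R}^+)$ with inverse (for $\alpha>0$) $(D_+^\alpha)^{-1}h(t)=\alpha\int_t^\infty(s-t)^{\alpha-1}\frac{h(s)}{s^\alpha}ds$. Both $\mathcal{S}_{\beta,\mu}$ (for $0<\beta-\frac1p<\mu$)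 and $\mathcal{C}_\gamma$ (for $\gamma>0$, $p>1$) are bounded on $\mathcal{T}_p^{(\alpha)}(t^\alpha)$. *)

theory Defs
  imports "HOL-Analysis.Analysis"
begin

text \<open>
  Functions on the half line are represented by functions on all of \<open>\<real>\<close>. Only their values on
  \<open>[0,\<infinity>)\<close> (for the Schwartz class) or on \<open>(0,\<infinity>)\<close> (for everything else) matter.
  Elements of \<open>L\<^sup>p(\<real>\<^sup>+)\<close> are represented by Borel functions, not by classes modulo null sets;
  all function spaces below are closed under modification on a null Borel set.
\<close>

definition schwartz_plus :: "(real \<Rightarrow> complex) set" where
  "schwartz_plus = {f. \<exists>g :: nat \<Rightarrow> real \<Rightarrow> complex.
      (\<forall>t\<ge>0. g 0 t = f t) \<and>
      (\<forall>n. \<forall>t\<ge>0. (g n has_vector_derivative g (Suc n) t) (at t within {0..})) \<and>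
      (\<forall>m n. \<exists>B. \<forall>t\<ge>0. norm (t ^ m *\<^sub>R g n t) \<le> B)}"

definition weyl_integral :: "real \<Rightarrow> (real \<Rightarrow> complex) \<Rightarrow> real \<Rightarrow> complex" where
  "weyl_integral \<alpha> f t =
     (1 / Gamma \<alpha>) *\<^sub>R (LINT s:{t<..}|lborel. ((s - t) powr (\<alpha> - 1)) *\<^sub>R f s)"

definition deriv_plus :: "(real \<Rightarrow> complex) \<Rightarrow> real \<Rightarrow> complex" where
  "deriv_plus f t = vector_derivative f (at t within {0..})"

definition weyl_derivative :: "real \<Rightarrow> (real \<Rightarrow> complex) \<Rightarrow> real \<Rightarrow> complex" where
  "weyl_derivative \<alpha> f =
     (if \<alpha> = 0 then f
      else (let n = nat \<lfloor>\<alpha>\<rfloor> + 1 in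
        (\<lambda>t. (-1) ^ n * (deriv_plus ^^ n) (weyl_integral (real n - \<alpha>) f) t)))"

definition Lp_plus :: "real \<Rightarrow> (real \<Rightarrow> complex) set" where
  "Lp_plus p = {f. set_borel_measurable lborel {0<..} f \<and>
      set_integrable lborel {0<..} (\<lambda>t. norm (f t) powr p)}"

definition Lp_norm_plus :: "real \<Rightarrow> (real \<Rightarrow> complex) \<Rightarrow> real" where
  "Lp_norm_plus p f = (LINT t:{0<..}|lborel. norm (f t) powr p) powr (1 / p)"

definition T_norm :: "real \<Rightarrow> real \<Rightarrow> (real \<Rightarrow> complex) \<Rightarrow> real" where
  "T_norm \<alpha> p f = (1 / Gamma (\<alpha> + 1)) *
     (LINT t:{0<..}|lborel. norm (weyl_derivative \<alpha> f t) powr p * t powr (\<alpha> * p)) powr (1 / p)"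

text \<open>
  The completion of the Schwartz class for \<^const>\<open>T_norm\<close>, realised inside \<open>L\<^sup>p(\<real>\<^sup>+)\<close> through the
  continuous embedding: the \<open>L\<^sup>p\<close> limits of the \<^const>\<open>T_norm\<close>-Cauchy sequences of Schwartz functions.
\<close>

definition T_space :: "real \<Rightarrow> real \<Rightarrow> (real \<Rightarrow> complex) set" where
  "T_space \<alpha> p =
     (if \<alpha> = 0 then Lp_plus p
      else {f \<in> Lp_plus p. \<exists>\<phi> :: nat \<Rightarrow> real \<Rightarrow> complex.
        (\<forall>k. \<phi> k \<in> schwartz_plus) \<and>
        (\<forall>e>0. \<exists>N. \<forall>j\<ge>N. \<forall>k\<ge>N. T_norm \<alpha> p (\<lambda>t. \<phi> j t - \<phi> k t) < e) \<and>
        (\<lambda>k. Lp_norm_plus p (\<lambda>t. \<phi> k t - f t)) \<longlonglongrightarrow> 0})"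

definition stieltjes :: "real \<Rightarrow> real \<Rightarrow> (real \<Rightarrow> complex) \<Rightarrow> real \<Rightarrow> complex" where
  "stieltjes \<beta> \<mu> f t = (t powr (\<mu> - \<beta>)) *\<^sub>R
     (LINT s:{0<..}|lborel. (s powr (\<beta> - 1) / (s + t) powr \<mu>) *\<^sub>R f s)"

definition cesaro :: "real \<Rightarrow> (real \<Rightarrow> complex) \<Rightarrow> real \<Rightarrow> complex" where
  "cesaro \<gamma> f t = (\<gamma> / t powr \<gamma>) *\<^sub>R
     (LINT s:{0<..<t}|lborel. ((t - s) powr (\<gamma> - 1)) *\<^sub>R f s)"

text \<open>The Gauss series, meaningful for \<open>\<bar>z\<bar> < 1\<close>.\<close>

definition hyp2F1 :: "real \<Rightarrow> real \<Rightarrow> real \<Rightarrow> real \<Rightarrow> real" where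
  "hyp2F1 a b c z = eval_fps (fps_hypergeo [a, b] [c] 1) z"

end

theory Submission
  imports Defs
begin

text \<open>
  Since \<open>\<T>\<^sub>p\<close> is contained in \<open>L\<^sup>p\<close>, only \<open>f \<in> L\<^sup>p(\<real>\<^sup>+)\<close> matters. Both operators are averages of dilates of \<open>f\<close>:
  \<open>\<S> f(t) = \<integral> w(v) f(tv) dv\<close> with \<open>w(v) = v^(\<beta>-1) (1+v)^(-\<mu>)\<close> on \<open>(0,\<infinity>)\<close>, and
  \<open>\<C> f(t) = \<gamma> \<integral> b(x) f(tx) dx\<close> with \<open>b(x) = (1-x)^(\<gamma>-1)\<close> on \<open>(0,1)\<close>. Such averages commute by Fubini.
  The required absolute integrability follows from Young's inequality in the form
  \<open>w(v) |f(cv)| \<le> c^(-1/p) (w(v)^q + c |f(cv)|^p)\<close>, \<open>1/p + 1/q = 1\<close>, because \<open>w \<in> L\<^sup>q\<close> and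
  \<open>b(x) x^(-1/p)\<close> is integrable.
  Substituting \<open>u = txv\<close> and swapping integrals again gives the kernel
  \<open>t^(\<mu>-\<beta>) u^(\<beta>-1) \<integral> x^(\<mu>-\<beta>) (1-x)^(\<gamma>-1) (u+tx)^(-\<mu>) dx\<close> over \<open>(0,1)\<close>, which Euler's integral identifies
  with \<open>\<^sub>2F\<^sub>1\<close> after \<open>x = 1 - y\<close>.
\<close>



section \<open>Both operators as weighted averages of dilates\<close>

definition stieltjes_weight :: "real \<Rightarrow> real \<Rightarrow> real \<Rightarrow> real" where
  "stieltjes_weight \<beta> \<mu> v = indicator {0<..} v * (v powr (\<beta> - 1) / (v + 1) powr \<mu>)"

text \<open>The indicators are built into both weights so that all integrals run over the whole
  line, where the affine substitution for \<open>lborel\<close> applies directly. The factor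
  \<gamma> stays outside.\<close>

definition cesaro_weight :: "real \<Rightarrow> real \<Rightarrow> real" where
  "cesaro_weight \<gamma> x = indicator {0<..<1} x * (1 - x) powr (\<gamma> - 1)"

lemma stieltjes_weight_nonneg: "stieltjes_weight \<beta> \<mu> v \<ge> 0"
  by (simp add: stieltjes_weight_def)

lemma cesaro_weight_nonneg: "cesaro_weight \<gamma> x \<ge> 0"
  by (simp add: cesaro_weight_def)

lemma measurable_stieltjes_weight [measurable]:
  "stieltjes_weight \<beta> \<mu> \<in> borel_measurable borel"
  unfolding stieltjes_weight_def by measurable

lemma measurable_cesaro_weight [measurable]: "cesaro_weight \<gamma> \<in> borel_measurable borel"
  unfolding cesaro_weight_def by measurable

text \<open>The Stieltjes kernel including its prefactor is homogeneous of degree -1 in (s, t), so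
  it is a function of s / t divided by t. This serves with t itself for the operator and with t x
  for the composition.\<close>

lemma stieltjes_weight_scale:
  assumes "t > 0"
  shows "stieltjes_weight \<beta> \<mu> (s / t) / t
    = t powr (\<mu> - \<beta>) * (indicator {0<..} s * (s powr (\<beta> - 1) / (s + t) powr \<mu>))"
proof (cases "s > 0")
  case True
  have "(s / t + 1) powr \<mu> = (s + t) powr \<mu> / t powr \<mu>"
    using assms True by (simp add: powr_divide add_divide_distrib flip: powr_divide)
  with assms True show ?thesis
    by (simp add: stieltjes_weight_def powr_divide powr_diff field_simps)
qed (use assms in \<open>simp add: stieltjes_weight_def indicator_def zero_less_divide_iff\<close>)

lemma stieltjes_eq:
  assumes "t > 0"
  shows "stieltjes \<beta> \<mu> f t = (LINT v|lborel. stieltjes_weight \<beta> \<mu> v *\<^sub>R f (t * v))"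
proof -
  have "(LINT v|lborel. stieltjes_weight \<beta> \<mu> v *\<^sub>R f (t * v))
      = (1 / t) *\<^sub>R (LINT s|lborel. stieltjes_weight \<beta> \<mu> (s / t) *\<^sub>R f s)"
    using lborel_integral_real_affine[of "1 / t" "\<lambda>v. stieltjes_weight \<beta> \<mu> v *\<^sub>R f (t * v)" 0] assms
    by simp
  also have "\<dots> = (LINT s|lborel. (stieltjes_weight \<beta> \<mu> (s / t) / t) *\<^sub>R f s)"
    by (simp flip: integral_scaleR_right)
  also have "\<dots> = stieltjes \<beta> \<mu> f t"
    unfolding stieltjes_def set_lebesgue_integral_def stieltjes_weight_scale[OF assms]
    by (simp flip: integral_scaleR_right add: mult_ac)
  finally show ?thesis ..
qed

lemma cesaro_eq:
  assumes "t > 0"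
  shows "cesaro \<gamma> f t = \<gamma> *\<^sub>R (LINT x|lborel. cesaro_weight \<gamma> x *\<^sub>R f (t * x))"
proof -
  \<comment> \<open>The integrand after s = t x. The factor \<open>t powr \<gamma> / t\<close> and
    the Jacobian t together cancel the denominator \<open>t powr \<gamma>\<close> in
    \<open>cesaro\<close>.\<close>
  have *: "indicator {0<..<t} (t * x) *\<^sub>R (t - t * x) powr (\<gamma> - 1) *\<^sub>R f (t * x)
      = (t powr \<gamma> / t) *\<^sub>R (cesaro_weight \<gamma> x *\<^sub>R f (t * x))" for x
  proof (cases "0 < x \<and> x < 1")
    case True
    have "(t * (1 - x)) powr (\<gamma> - 1) = t powr \<gamma> / t * (1 - x) powr (\<gamma> - 1)"
      using assms True by (simp add: powr_mult powr_diff)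
    with assms True show ?thesis
      by (simp add: cesaro_weight_def algebra_simps)
  next
    case False
    with assms show ?thesis
      by (auto simp: cesaro_weight_def indicator_def zero_less_mult_iff)
  qed
  have "(LINT s:{0<..<t}|lborel. ((t - s) powr (\<gamma> - 1)) *\<^sub>R f s)
      = t *\<^sub>R ((t powr \<gamma> / t) *\<^sub>R (LINT x|lborel. cesaro_weight \<gamma> x *\<^sub>R f (t * x)))"
    unfolding set_lebesgue_integral_def integral_scaleR_right[symmetric]
    by (subst lborel_integral_real_affine[of t _ 0])
      (use assms in \<open>simp_all only: * add_0 abs_of_pos less_imp_neq[symmetric] not_False_eq_True integral_scaleR_right\<close>)
  with assms show ?thesis
    by (simp add: cesaro_def)
qed

section \<open>Integrability of powers and weights, Young's inequality\<close>

lemma set_integrable_powr_Ioc: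
  assumes "a > -1"
  shows "set_integrable lborel {0<..1} (\<lambda>x::real. x powr a)"
proof -
  \<comment> \<open>The gauge integral of a nonnegative function is absolute, and Borel
    measurability then transfers integrability from the completed measure to
    \<open>lborel\<close>.\<close>
  have "set_integrable lebesgue {0..1} (\<lambda>x::real. x powr a)"
    by (intro nonnegative_absolutely_integrable_1 integrable_on_powr_from_0) (use assms in auto)
  then have "set_integrable lborel {0..1} (\<lambda>x::real. x powr a)"
    unfolding set_integrable_def by (subst (asm) integrable_completion) auto
  then show ?thesis
    by (rule set_integrable_subset) auto
qed

lemma set_integrable_powr_Ioi:
  assumes "a < -1"
  shows "set_integrable lborel {1<..} (\<lambda>x::real. x powr a)"
proof -
  have "set_integrable lebesgue {1..} (\<lambda>x::real. x powr a)"
    by (intro nonnegative_absolutely_integrable_1 has_integral_integrable[OF has_integral_powr_to_inf])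
      (use assms in auto)
  then have "set_integrable lborel {1..} (\<lambda>x::real. x powr a)"
    unfolding set_integrable_def by (subst (asm) integrable_completion) auto
  then show ?thesis
    by (rule set_integrable_subset) auto
qed

text \<open>The weight is dominated by \<open>v powr (\<beta> - 1)\<close>, used near 0, and by
  \<open>v powr (\<beta> - 1 - \<mu>)\<close>, used near infinity. For q = p / (p - 1) the two
  exponent conditions say exactly 0 < \<beta> - 1/p < \<mu>.\<close>

lemma integrable_stieltjes_weight_powr:
  assumes "q > 0" "\<mu> \<ge> 0" "q * (\<beta> - 1) > -1" "q * (\<beta> - 1 - \<mu>) < -1"
  shows "integrable lborel (\<lambda>v. stieltjes_weight \<beta> \<mu> v powr q)"
proof (rule Bochner_Integration.integrable_bound)
  show "integrable lborel (\<lambda>v::real. indicator {0<..1} v *\<^sub>R v powr (q * (\<beta> - 1))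
      + indicator {1<..} v *\<^sub>R v powr (q * (\<beta> - 1 - \<mu>)))"
    using set_integrable_powr_Ioc[OF assms(3)] set_integrable_powr_Ioi[OF assms(4)]
    unfolding set_integrable_def by (rule Bochner_Integration.integrable_add)
  have "stieltjes_weight \<beta> \<mu> v powr q \<le> v powr (q * (\<beta> - 1))" if "v > 0" for v
  proof -
    have "v powr (\<beta> - 1) / (v + 1) powr \<mu> \<le> v powr (\<beta> - 1) / 1"
      by (intro divide_left_mono ge_one_powr_ge_zero) (use that assms in auto)
    then have "stieltjes_weight \<beta> \<mu> v powr q \<le> (v powr (\<beta> - 1)) powr q"
      using that assms by (intro powr_mono2) (auto simp: stieltjes_weight_def)
    then show ?thesis by (simp add: powr_powr mult.commute)
  qed
  moreover have "stieltjes_weight \<beta> \<mu> v powr q \<le> v powr (q * (\<beta> - 1 - \<mu>))" if "v > 0" for v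
  proof -
    have "v powr (\<beta> - 1) / (v + 1) powr \<mu> \<le> v powr (\<beta> - 1) / v powr \<mu>"
      by (intro divide_left_mono powr_mono2) (use that assms in auto)
    then have "stieltjes_weight \<beta> \<mu> v powr q \<le> (v powr (\<beta> - 1 - \<mu>)) powr q"
      using that assms by (intro powr_mono2) (auto simp: stieltjes_weight_def powr_diff)
    then show ?thesis by (simp add: powr_powr mult.commute)
  qed
  ultimately show "AE v in lborel. norm (stieltjes_weight \<beta> \<mu> v powr q)
      \<le> norm (indicator {0<..1} v *\<^sub>R v powr (q * (\<beta> - 1))
        + indicator {1<..} v *\<^sub>R v powr (q * (\<beta> - 1 - \<mu>)))"
    by (intro AE_I2) (auto simp: indicator_def stieltjes_weight_def)
qed measurable

text \<open>Young's inequality for a and \<open>c powr (1 / p) * b\<close>, with the factors 1/q and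
  1/p bounded by 1. The parameter c will be a dilation factor: c times the integral of |g(cv)|^p
  does not depend on c.\<close>

lemma mult_le_powr_add:
  fixes a b c p :: real
  assumes "1 < p" "0 \<le> a" "0 \<le> b" "0 < c"
  shows "a * b \<le> c powr (- 1 / p) * (a powr (p / (p - 1)) + c * b powr p)"
proof -
  have "a * (c powr (1 / p) * b)
      \<le> a powr (p / (p - 1)) / (p / (p - 1)) + (c powr (1 / p) * b) powr p / p"
    by (intro Youngs_inequality) (use assms in \<open>auto simp: field_simps\<close>)
  also have "\<dots> \<le> a powr (p / (p - 1)) + (c powr (1 / p) * b) powr p"
  proof (intro add_mono)
    show "a powr (p / (p - 1)) / (p / (p - 1)) \<le> a powr (p / (p - 1))"
      using assms by (simp add: field_simps)
    show "(c powr (1 / p) * b) powr p / p \<le> (c powr (1 / p) * b) powr p"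
      using assms by (simp add: divide_le_eq mult_le_cancel_left1)
  qed
  also have "(c powr (1 / p) * b) powr p = c * b powr p"
    using assms by (simp add: powr_mult powr_powr)
  finally have *: "c powr (- 1 / p) * (a * (c powr (1 / p) * b))
      \<le> c powr (- 1 / p) * (a powr (p / (p - 1)) + c * b powr p)"
    by (intro mult_left_mono) auto
  have "c powr (- 1 / p) * c powr (1 / p) = 1"
    using assms by (simp flip: powr_add)
  then have "c powr (- 1 / p) * (a * (c powr (1 / p) * b)) = a * b"
    by (metis mult.left_commute mult.right_neutral mult.commute)
  with * show ?thesis by (simp only:)
qed

text \<open>For c \<noteq> 0 the map r \<mapsto> r c has the bounded linear left inverse z \<mapsto>
  Re (z / c), so both integrands are integrable or neither is, and no integrability assumption on f
  is needed. This lets a fixed value of g be pulled out of a kernel integral at every point.\<close>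

lemma integral_scaleR_complex:
  fixes f :: "'a \<Rightarrow> real" and c :: complex
  shows "(LINT x|M. f x *\<^sub>R c) = (LINT x|M. f x) *\<^sub>R c"
proof (cases "c = 0")
  case False
  show ?thesis
  proof (rule integral_bounded_linear'[of "\<lambda>r. r *\<^sub>R c" "\<lambda>z. Re (z / c)"])
    show "bounded_linear (\<lambda>r. r *\<^sub>R c)"
      by (rule bounded_linear_scaleR_left)
    show "bounded_linear (\<lambda>z. Re (z / c))"
      by (rule bounded_linear_compose[OF bounded_linear_Re bounded_linear_divide])
  qed (use False in \<open>auto simp: scaleR_conv_of_real\<close>)
qed simp

section \<open>Fubini for averages of dilates of a p-integrable function\<close>

context
  fixes g :: "real \<Rightarrow> complex" and b w :: "real \<Rightarrow> real" and p :: real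
  assumes p: "1 < p"
    and measurable_g [measurable]: "g \<in> borel_measurable borel"
    and measurable_b [measurable]: "b \<in> borel_measurable borel"
    and measurable_w [measurable]: "w \<in> borel_measurable borel"
    and integrable_g: "integrable lborel (\<lambda>x. norm (g x) powr p)"
    and integrable_b: "integrable lborel (\<lambda>x. b x * x powr (- 1 / p))"
    and integrable_w: "integrable lborel (\<lambda>x. w x powr (p / (p - 1)))"
    and b_nonneg: "\<And>x. b x \<ge> 0" and b_eq_0: "\<And>x. x \<le> 0 \<Longrightarrow> b x = 0"
    and w_nonneg: "\<And>x. w x \<ge> 0"
begin

text \<open>Integrate \<open>mult_le_powr_add\<close> with c as the dilation factor; the
  substitution absorbs c. Only \<open>c powr (- 1 / p)\<close> still depends on c, and
  \<open>integrable_b\<close> is the condition that makes this factor harmless when c = t x.\<close>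

lemma
  assumes "c > 0"
  shows integrable_weighted_dilation: "integrable lborel (\<lambda>v. w v *\<^sub>R g (c * v))"
    and integral_weighted_dilation_le: "(LINT v|lborel. norm (w v *\<^sub>R g (c * v)))
      \<le> ((LINT v|lborel. w v powr (p / (p - 1))) + (LINT v|lborel. norm (g v) powr p)) * c powr (- 1 / p)"
proof -
  let ?B = "\<lambda>v. c powr (- 1 / p) * (w v powr (p / (p - 1)) + c * norm (g (c * v)) powr p)"
  have int_g: "integrable lborel (\<lambda>v. norm (g (c * v)) powr p)"
    using lborel_integrable_real_affine[OF integrable_g, of c 0] assms by simp
  have bound: "norm (w v *\<^sub>R g (c * v)) \<le> ?B v" for v
    using mult_le_powr_add[OF p w_nonneg norm_ge_zero assms, of v "g (c * v)"] w_nonneg by simp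
  have int_B: "integrable lborel ?B"
    by (intro integrable_mult_right Bochner_Integration.integrable_add integrable_w int_g)
  show int: "integrable lborel (\<lambda>v. w v *\<^sub>R g (c * v))"
    by (rule Bochner_Integration.integrable_bound[OF int_B])
      (use bound in \<open>auto intro!: AE_I2 order_trans[OF _ abs_ge_self]\<close>)
  have "(LINT v|lborel. norm (w v *\<^sub>R g (c * v))) \<le> (LINT v|lborel. ?B v)"
    by (intro integral_mono integrable_norm int int_B bound)
  also have "\<dots> = c powr (- 1 / p) * ((LINT v|lborel. w v powr (p / (p - 1)))
      + c * (LINT v|lborel. norm (g (c * v)) powr p))"
    by (simp add: integrable_w int_g)
  also have "c * (LINT v|lborel. norm (g (c * v)) powr p) = (LINT v|lborel. norm (g v) powr p)"
    using lborel_integral_real_affine[of c "\<lambda>v. norm (g v) powr p" 0] assms by simp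
  finally show "(LINT v|lborel. norm (w v *\<^sub>R g (c * v)))
      \<le> ((LINT v|lborel. w v powr (p / (p - 1))) + (LINT v|lborel. norm (g v) powr p)) * c powr (- 1 / p)"
    by (simp only: mult.commute)
qed

text \<open>The integral of the norm over v is at most a constant times b(x) (t x)^(-1/p), which is
  integrable in x.\<close>

lemma integrable_dilation_product:
  assumes "t > 0"
  shows "integrable (lborel \<Otimes>\<^sub>M lborel) (\<lambda>(x, v). b x *\<^sub>R w v *\<^sub>R g (t * x * v))"
proof (rule lborel_pair.Fubini_integrable)
  let ?M = "(LINT v|lborel. w v powr (p / (p - 1))) + (LINT v|lborel. norm (g v) powr p)"
  have bound: "b x * (LINT v|lborel. norm (w v *\<^sub>R g (t * x * v)))
      \<le> ?M * t powr (- 1 / p) * (b x * x powr (- 1 / p))" for x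
  proof (cases "x > 0")
    case True
    then have "b x * (LINT v|lborel. norm (w v *\<^sub>R g (t * x * v)))
        \<le> b x * (?M * (t * x) powr (- 1 / p))"
      by (intro mult_left_mono integral_weighted_dilation_le b_nonneg) (use assms in auto)
    with True assms show ?thesis
      by (simp add: powr_mult mult_ac)
  qed (simp add: b_eq_0)
  have eq: "(LINT v|lborel. norm (case (x, v) of (x, v) \<Rightarrow> b x *\<^sub>R w v *\<^sub>R g (t * x * v)))
      = b x * (LINT v|lborel. norm (w v *\<^sub>R g (t * x * v)))" for x
    by (simp only: prod.case norm_scaleR[of "b x"] abs_of_nonneg[OF b_nonneg] integral_mult_right_zero)
  show "integrable lborel (\<lambda>x. LINT v|lborel. norm (case (x, v) of (x, v) \<Rightarrow> b x *\<^sub>R w v *\<^sub>R g (t * x * v)))"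
    unfolding eq
  proof (rule Bochner_Integration.integrable_bound)
    show "integrable lborel (\<lambda>x. ?M * t powr (- 1 / p) * (b x * x powr (- 1 / p)))"
      by (intro integrable_mult_right integrable_b)
    show "AE x in lborel. norm (b x * (LINT v|lborel. norm (w v *\<^sub>R g (t * x * v))))
        \<le> norm (?M * t powr (- 1 / p) * (b x * x powr (- 1 / p)))"
    proof (intro AE_I2)
      fix x
      have "norm (b x * (LINT v|lborel. norm (w v *\<^sub>R g (t * x * v))))
          = b x * (LINT v|lborel. norm (w v *\<^sub>R g (t * x * v)))"
        by (simp add: abs_mult b_nonneg)
      also have "\<dots> \<le> ?M * t powr (- 1 / p) * (b x * x powr (- 1 / p))"
        by (rule bound)
      also have "\<dots> \<le> norm (?M * t powr (- 1 / p) * (b x * x powr (- 1 / p)))"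
        by (simp only: real_norm_def abs_ge_self)
      finally show "norm (b x * (LINT v|lborel. norm (w v *\<^sub>R g (t * x * v))))
          \<le> norm (?M * t powr (- 1 / p) * (b x * x powr (- 1 / p)))" .
    qed
  qed measurable
  show "AE x in lborel. integrable lborel (\<lambda>v. case (x, v) of (x, v) \<Rightarrow> b x *\<^sub>R w v *\<^sub>R g (t * x * v))"
  proof (intro AE_I2)
    fix x :: real
    show "integrable lborel (\<lambda>v. case (x, v) of (x, v) \<Rightarrow> b x *\<^sub>R w v *\<^sub>R g (t * x * v))"
      using assms by (cases "x > 0")
        (auto simp: b_eq_0 simp del: scaleR_scaleR intro!: integrable_scaleR_right integrable_weighted_dilation)
  qed
qed measurable

text \<open>Dilations commute, so the two sides are the iterated integrals of the same function of
  (x, v) in the two orders.\<close>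

lemma dilation_average_commute:
  assumes "t > 0"
  shows "(LINT v|lborel. w v *\<^sub>R (LINT x|lborel. b x *\<^sub>R g (t * v * x)))
    = (LINT x|lborel. b x *\<^sub>R (LINT v|lborel. w v *\<^sub>R g (t * x * v)))"
proof -
  have "(LINT v|lborel. w v *\<^sub>R (LINT x|lborel. b x *\<^sub>R g (t * v * x)))
      = (LINT v|lborel. LINT x|lborel. b x *\<^sub>R w v *\<^sub>R g (t * x * v))"
    unfolding integral_scaleR_right[symmetric]
    by (intro Bochner_Integration.integral_cong refl) (simp add: mult_ac)
  also have "\<dots> = (LINT x|lborel. LINT v|lborel. b x *\<^sub>R w v *\<^sub>R g (t * x * v))"
    by (rule lborel_pair.Fubini_integral[OF integrable_dilation_product[OF assms]])
  finally show ?thesis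
    by (simp only: integral_scaleR_right)
qed

text \<open>For each x > 0 the substitution u = t x v preserves the integral of the norm, so the
  bound for \<open>integrable_dilation_product\<close> carries over without a new estimate.\<close>

lemma integrable_kernel_product:
  assumes "t > 0"
  shows "integrable (lborel \<Otimes>\<^sub>M lborel) (\<lambda>(x, u). (b x * (w (u / (t * x)) / (t * x))) *\<^sub>R g u)"
proof (rule lborel_pair.Fubini_integrable)
  have scale: "(LINT u|lborel. norm ((b x * (w (u / (t * x)) / (t * x))) *\<^sub>R g u))
      = (LINT v|lborel. norm (b x *\<^sub>R w v *\<^sub>R g (t * x * v)))" for x
  proof (cases "x > 0")
    case True
    with assms show ?thesis
      by (subst lborel_integral_real_affine[of "t * x" _ 0]) (simp_all add: field_simps flip: integral_mult_right_zero)
  qed (simp add: b_eq_0)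
  show "integrable lborel (\<lambda>x. LINT u|lborel. norm (case (x, u) of (x, u) \<Rightarrow> (b x * (w (u / (t * x)) / (t * x))) *\<^sub>R g u))"
    using lborel_pair.integrable_fst'[OF integrable_norm[OF integrable_dilation_product[OF assms]]]
    by (simp only: prod.case scale)
  show "AE x in lborel. integrable lborel (\<lambda>u. case (x, u) of (x, u) \<Rightarrow> (b x * (w (u / (t * x)) / (t * x))) *\<^sub>R g u)"
  proof (intro AE_I2)
    fix x :: real
    show "integrable lborel (\<lambda>u. case (x, u) of (x, u) \<Rightarrow> (b x * (w (u / (t * x)) / (t * x))) *\<^sub>R g u)"
    proof (cases "x > 0")
      case True
      then have "integrable lborel (\<lambda>v. (b x / (t * x)) *\<^sub>R w v *\<^sub>R g (t * x * v))"
        using assms by (intro integrable_scaleR_right integrable_weighted_dilation) simp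
      from lborel_integrable_real_affine[OF this, of "1 / (t * x)" 0] True assms show ?thesis
        by simp
    qed (simp add: b_eq_0)
  qed
qed measurable

text \<open>After u = t x v the function g no longer depends on x. Swapping the integrals therefore
  leaves \<open>g u\<close> as a constant in the inner one, whose remaining factor is the kernel of
  the composition.\<close>

lemma
  assumes "t > 0"
  shows integrable_dilation_kernel:
      "integrable lborel (\<lambda>u. (LINT x|lborel. b x * (w (u / (t * x)) / (t * x))) *\<^sub>R g u)"
    and dilation_average_eq_kernel:
      "(LINT x|lborel. b x *\<^sub>R (LINT v|lborel. w v *\<^sub>R g (t * x * v)))
        = (LINT u|lborel. (LINT x|lborel. b x * (w (u / (t * x)) / (t * x))) *\<^sub>R g u)"
proof -
  have scaleR: "(LINT x|lborel. (b x * (w (u / (t * x)) / (t * x))) *\<^sub>R g u)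
      = (LINT x|lborel. b x * (w (u / (t * x)) / (t * x))) *\<^sub>R g u" for u
    by (rule integral_scaleR_complex)
  show "integrable lborel (\<lambda>u. (LINT x|lborel. b x * (w (u / (t * x)) / (t * x))) *\<^sub>R g u)"
    using lborel_pair.integrable_snd[OF integrable_kernel_product[OF assms]] by (simp only: scaleR)
  have "b x *\<^sub>R (LINT v|lborel. w v *\<^sub>R g (t * x * v))
      = (LINT u|lborel. (b x * (w (u / (t * x)) / (t * x))) *\<^sub>R g u)" for x
  proof (cases "x > 0")
    case True
    with assms show ?thesis
      by (subst (2) lborel_integral_real_affine[of "t * x" _ 0]) (simp_all flip: integral_scaleR_right)
  qed (simp add: b_eq_0)
  then show "(LINT x|lborel. b x *\<^sub>R (LINT v|lborel. w v *\<^sub>R g (t * x * v)))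
        = (LINT u|lborel. (LINT x|lborel. b x * (w (u / (t * x)) / (t * x))) *\<^sub>R g u)"
    using lborel_pair.Fubini_integral[OF integrable_kernel_product[OF assms]] by (simp only: scaleR)
qed

end


section \<open>Beta integrals and Euler's integral for the hypergeometric function\<close>

lemma set_integrable_Beta:
  assumes "b > 0" "c > (0::real)"
  shows "set_integrable lborel {0<..<1} (\<lambda>y. y powr (b - 1) * (1 - y) powr (c - 1))"
  using integrable_Beta[OF assms] by (rule set_integrable_subset) auto

lemma Beta_real_eq_set_integral:
  assumes "b > 0" "c > (0::real)"
  shows "(LINT y:{0<..<1}|lborel. y powr (b - 1) * (1 - y) powr (c - 1)) = Beta b c"
  using has_integral_Beta_real[OF assms] set_borel_integral_eq_integral(2)[OF set_integrable_Beta[OF assms]]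
  by (simp add: has_integral_Icc_iff_Ioo integral_unique)

lemma Beta_real_pos:
  assumes "b > 0" "c > (0::real)"
  shows "Beta b c > 0"
  using assms by (simp add: Beta_def Gamma_real_pos)

text \<open>Iterates B(b+1, c) = b / (b+c) B(b, c). The resulting ratios are the coefficients
  contributed by b and b + c to the Gauss series.\<close>

lemma Beta_add_of_nat:
  fixes b c :: real
  assumes "b > 0" "c > 0"
  shows "Beta (b + of_nat n) c = Beta b c * (pochhammer b n / pochhammer (b + c) n)"
proof (induction n)
  case (Suc n)
  have "b + of_nat n \<notin> \<int>\<^sub>\<le>\<^sub>0"
    using assms by (auto elim!: nonpos_Ints_cases')
  from Beta_plus1_left[OF this, of c]
  have "(b + of_nat n + c) * Beta (b + of_nat (Suc n)) c = (b + of_nat n) * Beta (b + of_nat n) c"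
    by (simp add: add_ac)
  moreover have "b + of_nat n + c > 0" "pochhammer (b + c) n > 0"
    using assms by (auto intro!: add_pos_nonneg pochhammer_pos)
  ultimately have "Beta (b + of_nat (Suc n)) c = (b + of_nat n) * Beta (b + of_nat n) c / (b + of_nat n + c)"
    and "b + c + of_nat n \<noteq> 0"
    by (simp_all add: eq_divide_eq mult.commute)
  then show ?case
    by (simp only: Suc pochhammer_Suc) (simp add: ac_simps)
qed simp

text \<open>The binomial series at -z with exponent -a; the signs of the generalized binomial
  coefficients cancel those of the powers.\<close>

lemma one_minus_powr_sums:
  fixes a z :: real
  assumes "0 \<le> z" "z < 1"
  shows "(\<lambda>n. pochhammer a n / fact n * z ^ n) sums (1 - z) powr (- a)"
proof -
  have "(\<lambda>n. ((- a) gchoose n) * (- z) ^ n) sums (1 + (- z)) powr (- a)"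
    by (rule gen_binomial_real) (use assms in auto)
  moreover have "((- a) gchoose n) * (- z) ^ n = pochhammer a n / fact n * z ^ n" for n
  proof -
    have "(- 1) ^ n * (- z) ^ n = z ^ n"
      by (simp flip: power_mult_distrib)
    then show ?thesis
      by (simp add: gbinomial_pochhammer mult.left_commute mult.commute[of "(- 1) ^ n"])
  qed
  ultimately show ?thesis by simp
qed

lemma hyp2F1_eq_suminf:
  "hyp2F1 a b c z = (\<Sum>n. pochhammer a n * pochhammer b n / (pochhammer c n * fact n) * z ^ n)"
  by (simp add: hyp2F1_def eval_fps_def)

text \<open>The equal upper and lower parameters cancel, leaving the binomial series. Case (i) of
  the theorem is of this form.\<close>

lemma hyp2F1_cancel:
  assumes "a > 0" "0 \<le> z" "z < 1"
  shows "hyp2F1 a b a z = (1 - z) powr (- b)"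
proof -
  have "pochhammer a n \<noteq> 0" for n
    using pochhammer_pos[OF assms(1), of n] by simp
  then show ?thesis
    using sums_unique[OF one_minus_powr_sums[OF assms(2,3), of b]] by (simp add: hyp2F1_eq_suminf)
qed

text \<open>Expand \<open>(1 - z * y) powr (- a)\<close> in its binomial series and integrate term
  by term; each term is a Beta integral.\<close>

lemma hyp2F1_Euler_integral:
  assumes "a > 0" "b > 0" "c > 0" "0 \<le> z" "z < 1"
  shows "(LINT y:{0<..<1}|lborel. y powr (b - 1) * (1 - y) powr (c - 1) * (1 - z * y) powr (- a))
    = Beta b c * hyp2F1 a b (b + c) z"
proof -
  define h where "h y = indicator {0<..<1} y * (y powr (b - 1) * (1 - y) powr (c - 1))" for y :: real
  define r where "r n = pochhammer a n / fact n" for n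
  have [measurable]: "h \<in> borel_measurable borel"
    unfolding h_def by measurable
  have h_nonneg: "h y \<ge> 0" for y by (simp add: h_def)
  have r_nonneg: "r n \<ge> 0" for n
    using pochhammer_pos[OF assms(1), of n] by (simp add: r_def)
  have h_power: "h y * y ^ n = indicator {0<..<1} y *\<^sub>R (y powr (b + of_nat n - 1) * (1 - y) powr (c - 1))" for y n
    by (auto simp: h_def indicator_def powr_add powr_diff powr_realpow)
  have int: "integrable lborel (\<lambda>y. h y * y ^ n)" for n
    using set_integrable_Beta[of "b + of_nat n" c] assms by (simp add: h_power set_integrable_def)
  have LINT: "(LINT y|lborel. h y * y ^ n) = Beta b c * (pochhammer b n / pochhammer (b + c) n)" for n
    using Beta_real_eq_set_integral[of "b + of_nat n" c] Beta_add_of_nat[of b c n] assms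
    by (simp add: h_power set_lebesgue_integral_def)
  have sums: "(\<lambda>n. r n * (z * y) ^ n) sums (1 - z * y) powr (- a)" if "0 < y" "y < 1" for y
    unfolding r_def by (rule one_minus_powr_sums) (use that assms mult_strict_mono[of z 1 y 1] in auto)
  have "(\<lambda>N. LINT y|lborel. h y * (\<Sum>n<N. r n * (z * y) ^ n))
      \<longlonglongrightarrow> (LINT y|lborel. h y * (1 - z * y) powr (- a))"
  proof (rule integral_dominated_convergence)
    \<comment> \<open>The dominating function: the terms are nonnegative, so partial sums stay below
      (1 - z y)^(-a) \<le> (1 - z)^(-a).\<close>
    show "integrable lborel (\<lambda>y. h y * (1 - z) powr (- a))"
      using int[of 0] by simp
    show "AE y in lborel. (\<lambda>N. h y * (\<Sum>n<N. r n * (z * y) ^ n)) \<longlonglongrightarrow> h y * (1 - z * y) powr (- a)"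
    proof (intro AE_I2)
      fix y show "(\<lambda>N. h y * (\<Sum>n<N. r n * (z * y) ^ n)) \<longlonglongrightarrow> h y * (1 - z * y) powr (- a)"
        using sums[of y] by (cases "0 < y \<and> y < 1") (auto simp: h_def sums_def intro!: tendsto_mult_left)
    qed
    show "AE y in lborel. norm (h y * (\<Sum>n<N. r n * (z * y) ^ n)) \<le> h y * (1 - z) powr (- a)" for N
    proof (intro AE_I2)
      fix y show "norm (h y * (\<Sum>n<N. r n * (z * y) ^ n)) \<le> h y * (1 - z) powr (- a)"
      proof (cases "0 < y \<and> y < 1")
        case True
        have nonneg: "0 \<le> r n * (z * y) ^ n" for n
          using True assms by (intro mult_nonneg_nonneg r_nonneg) auto
        have "(\<Sum>n<N. r n * (z * y) ^ n) \<le> (1 - z * y) powr (- a)"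
          using sum_le_suminf[OF sums_summable[OF sums], of y "{..<N}"] sums_unique[OF sums, of y] True nonneg
          by simp
        also have "\<dots> \<le> (1 - z) powr (- a)"
          using True assms by (intro powr_mono2') (auto simp: mult_left_le)
        finally show ?thesis
          using h_nonneg nonneg by (simp add: abs_mult sum_nonneg mult_left_mono)
      qed (auto simp: h_def)
    qed
  qed measurable
  moreover have "(LINT y|lborel. h y * (\<Sum>n<N. r n * (z * y) ^ n))
      = (\<Sum>n<N. r n * z ^ n * (LINT y|lborel. h y * y ^ n))" for N
  proof -
    have "h y * (\<Sum>n<N. r n * (z * y) ^ n) = (\<Sum>n<N. r n * z ^ n * (h y * y ^ n))" for y
      by (simp add: sum_distrib_left power_mult_distrib mult_ac)
    then show ?thesis
      using int by simp
  qed
  ultimately have "(\<lambda>n. Beta b c * (pochhammer a n * pochhammer b n / (pochhammer (b + c) n * fact n) * z ^ n))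
      sums (LINT y|lborel. h y * (1 - z * y) powr (- a))"
    by (simp add: sums_def LINT r_def mult_ac)
  \<comment> \<open>Dividing the series just summed by this constant yields both the convergence and
    the value of the Gauss series.\<close>
  moreover have Beta: "Beta b c \<noteq> 0"
    using Beta_real_pos[OF assms(2,3)] by simp
  ultimately have "(LINT y|lborel. h y * (1 - z * y) powr (- a)) / Beta b c = hyp2F1 a b (b + c) z"
    unfolding hyp2F1_eq_suminf by (intro sums_unique sums_mult_D)
  with Beta have "(LINT y|lborel. h y * (1 - z * y) powr (- a)) = Beta b c * hyp2F1 a b (b + c) z"
    by (simp add: divide_eq_eq mult.commute)
  then show ?thesis
    by (simp add: h_def set_lebesgue_integral_def mult_ac)
qed


section \<open>The integral kernel of the composition and its closed forms\<close>

definition stieltjes_cesaro_kernel :: "real \<Rightarrow> real \<Rightarrow> real \<Rightarrow> real \<Rightarrow> real \<Rightarrow> real" where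
  "stieltjes_cesaro_kernel \<beta> \<mu> \<gamma> t u =
    (LINT x|lborel. cesaro_weight \<gamma> x * (stieltjes_weight \<beta> \<mu> (u / (t * x)) / (t * x)))"

text \<open>The scaling of the weight is applied with t x in place of t; the powers of x collect to
  \<open>x powr (\<mu> - \<beta>)\<close>. All closed forms below start from this integral.\<close>

lemma stieltjes_cesaro_kernel_eq:
  assumes "t > 0" "u > 0"
  shows "stieltjes_cesaro_kernel \<beta> \<mu> \<gamma> t u = t powr (\<mu> - \<beta>) * u powr (\<beta> - 1) *
    (LINT x:{0<..<1}|lborel. x powr (\<mu> - \<beta>) * (1 - x) powr (\<gamma> - 1) * (u + t * x) powr (- \<mu>))"
proof -
  have "cesaro_weight \<gamma> x * (stieltjes_weight \<beta> \<mu> (u / (t * x)) / (t * x))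
      = t powr (\<mu> - \<beta>) * u powr (\<beta> - 1) * (indicator {0<..<1} x *\<^sub>R
        (x powr (\<mu> - \<beta>) * (1 - x) powr (\<gamma> - 1) * (u + t * x) powr (- \<mu>)))" for x
  proof (cases "0 < x \<and> x < 1")
    case True
    then have "t * x > 0"
      using assms by simp
    from stieltjes_weight_scale[OF this, of \<beta> \<mu> u] True assms show ?thesis
      by (simp add: cesaro_weight_def powr_mult powr_minus divide_inverse mult_ac)
  qed (auto simp: cesaro_weight_def)
  then show ?thesis
    by (simp add: stieltjes_cesaro_kernel_def set_lebesgue_integral_def)
qed

text \<open>Specializes the averaging results to the two weights. The integrand b(x) x^(-1/p) is a
  Beta integrand with parameters 1 - 1/p and \<gamma>, and the range of \<beta> puts the Stieltjes
  weight into L^q.\<close>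

lemma stieltjes_cesaro:
  assumes f: "f \<in> Lp_plus p" and p: "1 < p" and \<gamma>: "\<gamma> > 0"
    and \<beta>: "0 < \<beta> - 1 / p" "\<beta> - 1 / p < \<mu>" and t: "t > 0"
  shows stieltjes_cesaro_commute:
      "stieltjes \<beta> \<mu> (cesaro \<gamma> f) t = cesaro \<gamma> (stieltjes \<beta> \<mu> f) t"
    and set_integrable_stieltjes_cesaro_kernel:
      "set_integrable lborel {0<..} (\<lambda>u. stieltjes_cesaro_kernel \<beta> \<mu> \<gamma> t u *\<^sub>R f u)"
    and stieltjes_cesaro_eq_kernel:
      "stieltjes \<beta> \<mu> (cesaro \<gamma> f) t
        = \<gamma> *\<^sub>R (LINT u:{0<..}|lborel. stieltjes_cesaro_kernel \<beta> \<mu> \<gamma> t u *\<^sub>R f u)"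
proof -
  \<comment> \<open>The cut-off is Borel on the whole line, whereas f is controlled only on the
    positive half line.\<close>
  define g where "g s = indicator {0<..} s *\<^sub>R f s" for s :: real
  let ?b = "cesaro_weight \<gamma>" and ?w = "stieltjes_weight \<beta> \<mu>"
  have mg: "g \<in> borel_measurable borel"
    using f by (simp add: Lp_plus_def set_borel_measurable_def g_def[abs_def])
  have "norm (g s) powr p = indicator {0<..} s *\<^sub>R norm (f s) powr p" for s
    using p by (simp add: g_def indicator_def)
  then have int_g: "integrable lborel (\<lambda>s. norm (g s) powr p)"
    using f by (simp add: Lp_plus_def set_integrable_def)
  have "?b x * x powr (- 1 / p)
      = indicator {0<..<1} x *\<^sub>R (x powr ((1 - 1 / p) - 1) * (1 - x) powr (\<gamma> - 1))" for x
    by (simp add: cesaro_weight_def)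
  then have int_b: "integrable lborel (\<lambda>x. ?b x * x powr (- 1 / p))"
    using set_integrable_Beta[of "1 - 1 / p" \<gamma>] p \<gamma> by (simp only: set_integrable_def) simp
  have int_w: "integrable lborel (\<lambda>v. ?w v powr (p / (p - 1)))"
  proof (rule integrable_stieltjes_weight_powr)
    show "\<mu> \<ge> 0"
      using \<beta> by linarith
  qed (use p \<beta> in \<open>simp_all add: field_simps\<close>)
  have b0: "?b x = 0" if "x \<le> 0" for x
    using that by (simp add: cesaro_weight_def)
  \<comment> \<open>The assumptions of the context in their order, followed by the premise t > 0 of
    its lemmas.\<close>
  note avg = p mg measurable_cesaro_weight measurable_stieltjes_weight int_g int_b int_w
    cesaro_weight_nonneg b0 stieltjes_weight_nonneg t
  have w_eq: "?w v *\<^sub>R f (s * v) = ?w v *\<^sub>R g (s * v)" if "s > 0" for s v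
    using that by (simp add: stieltjes_weight_def g_def indicator_def)
  have b_eq: "?b x *\<^sub>R f (s * x) = ?b x *\<^sub>R g (s * x)" if "s > 0" for s x
    using that by (simp add: cesaro_weight_def g_def indicator_def)
  have "?w v *\<^sub>R cesaro \<gamma> f (t * v) = \<gamma> *\<^sub>R (?w v *\<^sub>R (LINT x|lborel. ?b x *\<^sub>R g (t * v * x)))" for v
  proof (cases "v > 0")
    case True
    with t show ?thesis
      by (simp add: cesaro_eq b_eq)
  qed (simp add: stieltjes_weight_def)
  then have SC: "stieltjes \<beta> \<mu> (cesaro \<gamma> f) t
      = \<gamma> *\<^sub>R (LINT v|lborel. ?w v *\<^sub>R (LINT x|lborel. ?b x *\<^sub>R g (t * v * x)))"
    unfolding stieltjes_eq[OF t] by (simp only: integral_scaleR_right)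
  have "?b x *\<^sub>R stieltjes \<beta> \<mu> f (t * x) = ?b x *\<^sub>R (LINT v|lborel. ?w v *\<^sub>R g (t * x * v))" for x
  proof (cases "x > 0")
    case True
    with t show ?thesis
      by (simp add: stieltjes_eq w_eq)
  qed (simp add: b0)
  then have CS: "cesaro \<gamma> (stieltjes \<beta> \<mu> f) t
      = \<gamma> *\<^sub>R (LINT x|lborel. ?b x *\<^sub>R (LINT v|lborel. ?w v *\<^sub>R g (t * x * v)))"
    unfolding cesaro_eq[OF t] by (simp only:)
  show eq: "stieltjes \<beta> \<mu> (cesaro \<gamma> f) t = cesaro \<gamma> (stieltjes \<beta> \<mu> f) t"
    unfolding SC CS by (subst dilation_average_commute[OF avg]) simp_all
  have K: "indicator {0<..} u *\<^sub>R stieltjes_cesaro_kernel \<beta> \<mu> \<gamma> t u *\<^sub>R f u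
      = stieltjes_cesaro_kernel \<beta> \<mu> \<gamma> t u *\<^sub>R g u" for u
    by (simp add: g_def)
  show "set_integrable lborel {0<..} (\<lambda>u. stieltjes_cesaro_kernel \<beta> \<mu> \<gamma> t u *\<^sub>R f u)"
    unfolding set_integrable_def K
    unfolding stieltjes_cesaro_kernel_def by (rule integrable_dilation_kernel[OF avg])
  show "stieltjes \<beta> \<mu> (cesaro \<gamma> f) t
      = \<gamma> *\<^sub>R (LINT u:{0<..}|lborel. stieltjes_cesaro_kernel \<beta> \<mu> \<gamma> t u *\<^sub>R f u)"
    unfolding eq CS set_lebesgue_integral_def K unfolding stieltjes_cesaro_kernel_def
    by (subst dilation_average_eq_kernel[OF avg]) simp_all
qed

text \<open>Reduces each formula of the theorem to a closed form of the kernel for u > 0. Since c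
  \<noteq> 0, integrability against the kernel passes to k.\<close>

lemma stieltjes_cesaro_kernel_multiple:
  assumes "f \<in> Lp_plus p" "1 < p" "\<gamma> > 0" "0 < \<beta> - 1 / p" "\<beta> - 1 / p < \<mu>" "t > 0"
    and c: "c \<noteq> 0"
    and K: "\<And>u. u > 0 \<Longrightarrow> stieltjes_cesaro_kernel \<beta> \<mu> \<gamma> t u = c * k u"
  shows "set_integrable lborel {0<..} (\<lambda>u. k u *\<^sub>R f u)"
    and "stieltjes \<beta> \<mu> (cesaro \<gamma> f) t = (\<gamma> * c) *\<^sub>R (LINT u:{0<..}|lborel. k u *\<^sub>R f u)"
proof -
  have "set_integrable lborel {0<..} (\<lambda>u. (1 / c) *\<^sub>R stieltjes_cesaro_kernel \<beta> \<mu> \<gamma> t u *\<^sub>R f u)"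
    by (intro set_integrable_scaleR_right set_integrable_stieltjes_cesaro_kernel[OF assms(1-6)])
  then show "set_integrable lborel {0<..} (\<lambda>u. k u *\<^sub>R f u)"
    by (rule set_integrable_cong[THEN iffD1, rotated -1]) (use c K in auto)
  have "(LINT u:{0<..}|lborel. stieltjes_cesaro_kernel \<beta> \<mu> \<gamma> t u *\<^sub>R f u)
      = c *\<^sub>R (LINT u:{0<..}|lborel. k u *\<^sub>R f u)"
    unfolding set_integral_scaleR_right[symmetric]
    by (intro set_lebesgue_integral_cong) (use K in auto)
  then show "stieltjes \<beta> \<mu> (cesaro \<gamma> f) t = (\<gamma> * c) *\<^sub>R (LINT u:{0<..}|lborel. k u *\<^sub>R f u)"
    unfolding stieltjes_cesaro_eq_kernel[OF assms(1-6)]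
    by (simp only: scaleR_scaleR)
qed

text \<open>Put x = 1 - y and z = t / (u + t). Then u + t x = (u + t)(1 - z y), and Euler's integral
  applies with parameters \<mu>, \<gamma> and \<mu> - \<beta> + 1.\<close>

lemma stieltjes_cesaro_kernel_hyp2F1:
  assumes "t > 0" "u > 0" "\<gamma> > 0" "\<mu> > 0" "\<mu> - \<beta> + 1 > 0"
  shows "stieltjes_cesaro_kernel \<beta> \<mu> \<gamma> t u = Beta \<gamma> (\<mu> - \<beta> + 1) * t powr (\<mu> - \<beta>) *
    (u powr (\<beta> - 1) / (u + t) powr \<mu> * hyp2F1 \<mu> \<gamma> (\<mu> - \<beta> + 1 + \<gamma>) (t / (u + t)))"
proof -
  let ?z = "t / (u + t)"
  \<comment> \<open>The arguments have the literal shape produced by the affine substitution with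
    slope -1 and offset 1.\<close>
  have integrand: "indicator {0<..<1} (1 + - 1 * y) *\<^sub>R ((1 + - 1 * y) powr (\<mu> - \<beta>) *
        (1 - (1 + - 1 * y)) powr (\<gamma> - 1) * (u + t * (1 + - 1 * y)) powr (- \<mu>))
      = (u + t) powr (- \<mu>) * (indicator {0<..<1} y *\<^sub>R
        (y powr (\<gamma> - 1) * (1 - y) powr (\<mu> - \<beta> + 1 - 1) * (1 - ?z * y) powr (- \<mu>)))" for y
  proof (cases "0 < y \<and> y < 1")
    case True
    have "u + t * (1 - y) = (u + t) * (1 - ?z * y)"
      using assms by (simp add: field_simps)
    moreover have "?z * y \<le> 1"
      using True assms by (simp add: field_simps) (smt (verit) mult_left_le)
    ultimately have "(u + t * (1 - y)) powr (- \<mu>) = (u + t) powr (- \<mu>) * (1 - ?z * y) powr (- \<mu>)"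
      using assms by (simp only: powr_mult)
    with True show ?thesis by simp
  qed (auto simp: indicator_def)
  have "(LINT x:{0<..<1}|lborel. x powr (\<mu> - \<beta>) * (1 - x) powr (\<gamma> - 1) * (u + t * x) powr (- \<mu>))
      = (u + t) powr (- \<mu>) * (LINT y:{0<..<1}|lborel.
        y powr (\<gamma> - 1) * (1 - y) powr (\<mu> - \<beta> + 1 - 1) * (1 - ?z * y) powr (- \<mu>))"
    unfolding set_lebesgue_integral_def
    by (subst lborel_integral_real_affine[of "-1" _ 1])
      (simp_all only: integrand integral_mult_right_zero, simp_all)
  also have "\<dots> = (u + t) powr (- \<mu>) * (Beta \<gamma> (\<mu> - \<beta> + 1) * hyp2F1 \<mu> \<gamma> (\<gamma> + (\<mu> - \<beta> + 1)) ?z)"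
    by (subst hyp2F1_Euler_integral) (use assms in auto)
  finally show ?thesis
    using assms by (simp add: stieltjes_cesaro_kernel_eq powr_minus field_simps)
qed

text \<open>For \<mu> = \<beta> and \<gamma> = 1 the factors x^(\<mu>-\<beta>) and
  (1-x)^(\<gamma>-1) are 1 on (0,1), so the fundamental theorem of calculus evaluates the kernel
  directly.\<close>

lemma stieltjes_cesaro_kernel_antiderivative:
  assumes "t > 0" "u > 0"
    and F: "\<And>x. 0 \<le> x \<Longrightarrow> x \<le> 1 \<Longrightarrow> (F has_real_derivative (u + t * x) powr (- \<beta>)) (at x)"
  shows "stieltjes_cesaro_kernel \<beta> \<beta> 1 t u = u powr (\<beta> - 1) * (F 1 - F 0)"
proof -
  have "(LINT x:{0<..<1}|lborel. x powr (\<beta> - \<beta>) * (1 - x) powr (1 - 1) * (u + t * x) powr (- \<beta>))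
      = (LINT x|lborel. (u + t * x) powr (- \<beta>) * indicator {0..1} x)"
    unfolding set_lebesgue_integral_def
  proof (rule integral_cong_AE)
    \<comment> \<open>The integrands differ only at the endpoints 0 and 1.\<close>
    show "AE x in lborel. indicator {0<..<1} x *\<^sub>R (x powr (\<beta> - \<beta>) * (1 - x) powr (1 - 1) * (u + t * x) powr (- \<beta>))
        = (u + t * x) powr (- \<beta>) * indicator {0..1} x"
      using AE_lborel_singleton[of 0] AE_lborel_singleton[of 1]
      by eventually_elim (auto simp: indicator_def)
  qed measurable
  also have "\<dots> = F 1 - F 0"
  proof (intro integral_FTC_Icc_real F)
    fix x :: real assume "0 \<le> x" "x \<le> 1"
    then have "u + t * x > 0"
      using assms by (intro add_pos_nonneg) auto
    then show "isCont (\<lambda>x. (u + t * x) powr (- \<beta>)) x"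
      by (intro continuous_intros) auto
  qed auto
  finally show ?thesis
    using assms by (simp add: stieltjes_cesaro_kernel_eq)
qed

text \<open>An antiderivative is
  \<open>(u + t * x) powr (1 - \<beta>) / ((1 - \<beta>) * t)\<close>; powers with exponent 1 -
  \<beta> are then rewritten as reciprocals.\<close>

lemma stieltjes_cesaro_kernel_1:
  assumes "t > 0" "u > 0" "\<beta> \<noteq> 1"
  shows "stieltjes_cesaro_kernel \<beta> \<beta> 1 t u
    = (1 / ((\<beta> - 1) * t)) * (((t + u) powr (\<beta> - 1) - u powr (\<beta> - 1)) / (t + u) powr (\<beta> - 1))"
proof -
  have "((\<lambda>x. (u + t * x) powr (1 - \<beta>) / ((1 - \<beta>) * t)) has_real_derivative (u + t * x) powr (- \<beta>)) (at x)"
    if "0 \<le> x" for x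
  proof -
    have pos: "u + t * x > 0"
      using assms that by (intro add_pos_nonneg) auto
    have "((\<lambda>x. u + t * x) has_real_derivative t) (at x)"
      by (auto intro!: derivative_eq_intros)
    from DERIV_cdivide[OF DERIV_fun_powr[OF this pos, of "1 - \<beta>"], of "(1 - \<beta>) * t"] assms show ?thesis
      by simp
  qed
  from stieltjes_cesaro_kernel_antiderivative[OF assms(1,2) this]
  have "stieltjes_cesaro_kernel \<beta> \<beta> 1 t u
      = u powr (\<beta> - 1) * (((t + u) powr (1 - \<beta>) - u powr (1 - \<beta>)) / ((1 - \<beta>) * t))"
    by (simp add: add.commute diff_divide_distrib)
  moreover have "(t + u) powr (1 - \<beta>) = 1 / (t + u) powr (\<beta> - 1)" "u powr (1 - \<beta>) = 1 / u powr (\<beta> - 1)"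
    using powr_minus_divide[of "t + u" "\<beta> - 1"] powr_minus_divide[of u "\<beta> - 1"] by simp_all
  ultimately show ?thesis
    using assms by (simp add: divide_simps) (simp add: algebra_simps)
qed

text \<open>The exceptional exponent, where the antiderivative becomes
  \<open>ln (u + t * x) / t\<close>.\<close>

lemma stieltjes_cesaro_kernel_1_1:
  assumes "t > 0" "u > 0"
  shows "stieltjes_cesaro_kernel 1 1 1 t u = (1 / t) * ln (1 + t / u)"
proof -
  have "((\<lambda>x. ln (u + t * x) / t) has_real_derivative (u + t * x) powr (- 1)) (at x)" if "0 \<le> x" for x
  proof -
    have pos: "u + t * x > 0"
      using assms that by (intro add_pos_nonneg) auto
    have "((\<lambda>x. u + t * x) has_real_derivative t) (at x)"
      by (auto intro!: derivative_eq_intros)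
    from DERIV_cdivide[OF DERIV_chain2[OF DERIV_ln_divide[OF pos] this], of t] assms pos show ?thesis
      by (simp add: powr_minus_divide)
  qed
  from stieltjes_cesaro_kernel_antiderivative[OF assms this]
  have "stieltjes_cesaro_kernel 1 1 1 t u = (1 / t) * (ln (u + t) - ln u)"
    using assms by (simp add: diff_divide_distrib)
  also have "ln (u + t) - ln u = ln ((u + t) / u)"
    using assms by (simp add: ln_div)
  also have "(u + t) / u = 1 + t / u"
    using assms by (simp add: field_simps)
  finally show ?thesis .
qed

section \<open>The theorem on the spaces \<open>T_space\<close>\<close>

lemma T_space_subset_Lp_plus: "T_space \<alpha> p \<subseteq> Lp_plus p"
  by (auto simp: T_space_def)

theorem theorem1:
  fixes \<alpha> p \<gamma> :: real
  assumes "\<alpha> \<ge> 0" and "1 < p" and "\<gamma> > 0"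
  shows
    "(\<forall>\<beta> \<mu>. 0 < \<beta> - 1 / p \<and> \<beta> - 1 / p < \<mu> \<longrightarrow>
       (\<forall>f \<in> T_space \<alpha> p. \<forall>t>0.
          stieltjes \<beta> \<mu> (cesaro \<gamma> f) t = cesaro \<gamma> (stieltjes \<beta> \<mu> f) t \<and>
          set_integrable lborel {0<..}
            (\<lambda>s. (s powr (\<beta> - 1) / (s + t) powr \<mu> *
                  hyp2F1 \<mu> \<gamma> (\<mu> - \<beta> + 1 + \<gamma>) (t / (s + t))) *\<^sub>R f s) \<and>
          stieltjes \<beta> \<mu> (cesaro \<gamma> f) t =
            (\<gamma> * Beta \<gamma> (\<mu> - \<beta> + 1) * t powr (\<mu> - \<beta>)) *\<^sub>R
            (LINT s:{0<..}|lborel.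
               (s powr (\<beta> - 1) / (s + t) powr \<mu> *
                hyp2F1 \<mu> \<gamma> (\<mu> - \<beta> + 1 + \<gamma>) (t / (s + t))) *\<^sub>R f s)))
     \<and>
     (\<forall>\<mu>. \<mu> > \<gamma> + 1 - 1 / p \<longrightarrow>
       (\<forall>f \<in> T_space \<alpha> p. \<forall>t>0.
          stieltjes (\<gamma> + 1) \<mu> (cesaro \<gamma> f) t =
            (\<gamma> * Beta \<gamma> (\<mu> - \<gamma>)) *\<^sub>R stieltjes 1 (\<mu> - \<gamma>) f t))
     \<and>
     (\<forall>\<beta>. \<beta> > 1 / p \<and> \<beta> \<noteq> 1 \<longrightarrow>
       (\<forall>f \<in> T_space \<alpha> p. \<forall>t>0.
          set_integrable lborel {0<..}
            (\<lambda>s. (((t + s) powr (\<beta> - 1) - s powr (\<beta> - 1)) / (t + s) powr (\<beta> - 1)) *\<^sub>R f s) \<and>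
          stieltjes \<beta> \<beta> (cesaro 1 f) t =
            (1 / ((\<beta> - 1) * t)) *\<^sub>R
            (LINT s:{0<..}|lborel.
               (((t + s) powr (\<beta> - 1) - s powr (\<beta> - 1)) / (t + s) powr (\<beta> - 1)) *\<^sub>R f s)))
     \<and>
     (\<forall>f \<in> T_space \<alpha> p. \<forall>t>0.
        set_integrable lborel {0<..} (\<lambda>s. ln (1 + t / s) *\<^sub>R f s) \<and>
        stieltjes 1 1 (cesaro 1 f) t =
          (1 / t) *\<^sub>R (LINT s:{0<..}|lborel. ln (1 + t / s) *\<^sub>R f s))"
proof (intro conjI allI impI ballI; (elim conjE)?)
  fix \<beta> \<mu> f t
  assume \<beta>: "0 < \<beta> - 1 / p" "\<beta> - 1 / p < \<mu>" and "f \<in> T_space \<alpha> p" and t: "(t::real) > 0"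
  then have f: "f \<in> Lp_plus p"
    using T_space_subset_Lp_plus by blast
  show "stieltjes \<beta> \<mu> (cesaro \<gamma> f) t = cesaro \<gamma> (stieltjes \<beta> \<mu> f) t"
    by (rule stieltjes_cesaro_commute[OF f assms(2,3) \<beta> t])
  \<comment> \<open>Hence \<mu> - \<beta> + 1 > 1 - 1/p > 0, so the second Beta parameter is
    positive.\<close>
  have "1 / p < 1"
    using assms by simp
  then have pos: "\<mu> > 0" "\<mu> - \<beta> + 1 > 0"
    using \<beta> by auto
  then have "Beta \<gamma> (\<mu> - \<beta> + 1) * t powr (\<mu> - \<beta>) \<noteq> 0"
    using Beta_real_pos[OF assms(3) pos(2)] t by simp
  note * = stieltjes_cesaro_kernel_multiple[OF f assms(2,3) \<beta> t this
      stieltjes_cesaro_kernel_hyp2F1[OF t _ assms(3) pos]]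
  show "set_integrable lborel {0<..}
      (\<lambda>s. (s powr (\<beta> - 1) / (s + t) powr \<mu> *
        hyp2F1 \<mu> \<gamma> (\<mu> - \<beta> + 1 + \<gamma>) (t / (s + t))) *\<^sub>R f s)"
    by (rule *(1))
  show "stieltjes \<beta> \<mu> (cesaro \<gamma> f) t = (\<gamma> * Beta \<gamma> (\<mu> - \<beta> + 1) * t powr (\<mu> - \<beta>)) *\<^sub>R
      (LINT s:{0<..}|lborel. (s powr (\<beta> - 1) / (s + t) powr \<mu> *
        hyp2F1 \<mu> \<gamma> (\<mu> - \<beta> + 1 + \<gamma>) (t / (s + t))) *\<^sub>R f s)"
    using *(2) by (simp only: mult.assoc)
next
  fix \<mu> f t
  assume \<mu>: "\<gamma> + 1 - 1 / p < \<mu>" and "f \<in> T_space \<alpha> p" and t: "(t::real) > 0"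
  then have f: "f \<in> Lp_plus p"
    using T_space_subset_Lp_plus by blast
  have "1 / p < 1"
    using assms by simp
  then have pos: "\<mu> > 0" "\<mu> - (\<gamma> + 1) + 1 > 0" and \<beta>: "0 < \<gamma> + 1 - 1 / p"
    using \<mu> assms(3) by auto
  have c: "Beta \<gamma> (\<mu> - (\<gamma> + 1) + 1) * t powr (\<mu> - (\<gamma> + 1)) \<noteq> 0"
    using Beta_real_pos[OF assms(3) pos(2)] t by simp
  \<comment> \<open>For \<beta> = \<gamma> + 1 the lower parameter \<mu> - \<beta> + 1 + \<gamma>
    equals \<mu>, so the hypergeometric factor is ((u + t) / u)^\<gamma> and turns u^\<gamma> / (u +
    t)^\<mu> into (u + t)^(\<gamma>-\<mu>). The factor \<open>u powr (1 - 1)\<close> matches the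
    shape of \<open>stieltjes 1\<close>.\<close>
  have K: "stieltjes_cesaro_kernel (\<gamma> + 1) \<mu> \<gamma> t u = Beta \<gamma> (\<mu> - (\<gamma> + 1) + 1) * t powr (\<mu> - (\<gamma> + 1)) *
      (u powr (1 - 1) / (u + t) powr (\<mu> - \<gamma>))" if u: "u > 0" for u
  proof -
    have "1 - t / (u + t) = u / (u + t)"
      using u t by (simp add: field_simps)
    then have "hyp2F1 \<mu> \<gamma> \<mu> (t / (u + t)) = (u / (u + t)) powr (- \<gamma>)"
      using hyp2F1_cancel[OF pos(1), of "t / (u + t)" \<gamma>] u t by simp
    also have "\<dots> = (u + t) powr \<gamma> / u powr \<gamma>"
      using u t by (simp add: powr_minus powr_divide)
    finally have "hyp2F1 \<mu> \<gamma> \<mu> (t / (u + t)) = (u + t) powr \<gamma> / u powr \<gamma>" .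
    with stieltjes_cesaro_kernel_hyp2F1[OF t u assms(3) pos] u t show ?thesis
      by (simp add: powr_diff)
  qed
  show "stieltjes (\<gamma> + 1) \<mu> (cesaro \<gamma> f) t = (\<gamma> * Beta \<gamma> (\<mu> - \<gamma>)) *\<^sub>R stieltjes 1 (\<mu> - \<gamma>) f t"
    using stieltjes_cesaro_kernel_multiple(2)[OF f assms(2,3) \<beta> \<mu> t c K]
    by (simp add: stieltjes_def[of 1] diff_diff_eq mult.assoc)
next
  fix \<beta> f t
  assume \<beta>: "1 / p < \<beta>" "\<beta> \<noteq> 1" and "f \<in> T_space \<alpha> p" and t: "(t::real) > 0"
  then have f: "f \<in> Lp_plus p"
    using T_space_subset_Lp_plus by blast
  have \<beta>': "0 < \<beta> - 1 / p" "\<beta> - 1 / p < \<beta>"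
    using \<beta> assms(2) by auto
  have "1 / ((\<beta> - 1) * t) \<noteq> 0"
    using \<beta> t by simp
  note * = stieltjes_cesaro_kernel_multiple[OF f assms(2) zero_less_one \<beta>' t this
      stieltjes_cesaro_kernel_1[OF t _ \<beta>(2)]]
  show "set_integrable lborel {0<..}
      (\<lambda>s. (((t + s) powr (\<beta> - 1) - s powr (\<beta> - 1)) / (t + s) powr (\<beta> - 1)) *\<^sub>R f s)"
    by (rule *(1))
  show "stieltjes \<beta> \<beta> (cesaro 1 f) t = (1 / ((\<beta> - 1) * t)) *\<^sub>R
      (LINT s:{0<..}|lborel.
        (((t + s) powr (\<beta> - 1) - s powr (\<beta> - 1)) / (t + s) powr (\<beta> - 1)) *\<^sub>R f s)"
    using *(2) by (simp only: mult_1_left)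
next
  fix f t
  assume "f \<in> T_space \<alpha> p" and t: "(t::real) > 0"
  then have f: "f \<in> Lp_plus p"
    using T_space_subset_Lp_plus by blast
  have \<beta>: "0 < 1 - 1 / p" "1 - 1 / p < 1"
    using assms(2) by auto
  have "1 / t \<noteq> 0"
    using t by simp
  note * = stieltjes_cesaro_kernel_multiple[OF f assms(2) zero_less_one \<beta> t this
      stieltjes_cesaro_kernel_1_1[OF t]]
  show "set_integrable lborel {0<..} (\<lambda>s. ln (1 + t / s) *\<^sub>R f s)"
    by (rule *(1))
  show "stieltjes 1 1 (cesaro 1 f) t = (1 / t) *\<^sub>R (LINT s:{0<..}|lborel. ln (1 + t / s) *\<^sub>R f s)"
    using *(2) by (simp only: mult_1_left)
qed

end
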